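(* Let $u_->u_+$ and $\rho_-\neq\rho_+$. For each fixed $\epsilon_1>0$, assume that $(\rho^{\epsilon_1},u^{\epsilon_1})$ is a $\delta$-shock solution of $$\rho_t+(\rho u-2\epsilon_1u)_x=0,\qquad(\rho u)_t+(\rho u^2-\epsilon_1u^2)_x=0$$ with Riemann data $(\rho,u)(0,x)=(\rho_-,u_-)$ for $x<0$ and $(\rho,u)(0,x)=(\rho_+,u_+)$ for $x>0$ (with $\rho_\pm\ge2\epsilon_1$). Then, when $\epsilon_1\to0$, the pair of limit functions $(\rho,u)$ is a $\delta$-shock solution of the zero-pressure system $$\rho_t+(\rho u)_x=0,\qquad(\rho u)_t+(\rho u^2)_x=0$$ with the same Riemann data. Moreover, $\rho$ and $\rho u$ are the sum of a step function and a $\delta$-measure with weights $$\frac{t}{\sqrt{1+\sigma^2}}\big(\sigma[\rho]-[\rho u]\big)\quad\text{and}\quad\frac{t}{\sqrt{1+\sigma^2}}\big(\sigma[\rho u]-[\rho u^2]\big),$$ respectively, where $\sigma=\dfrac{\sqrt{\rho_+}u_++\sqrt{\rho_-}u_-}{\sqrt{\rho_+}+\sqrt{\rho_-}}$.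
   Context: Here $[g]=g_+-g_-$, e.g. $[\rho u]=\rho_+u_+-\rho_-u_-$. For $\epsilon\ge0$ consider the system $\rho_t+(\rho u-2\epsilon u)_x=0$, $(\rho u)_t+(\rho u^2-\epsilon u^2)_x=0$; the case $\epsilon=0$ is the zero-pressure system. A $\delta$-shock solution of it with the given Riemann data has the form $\rho=\rho_0+w(t)\delta_S$, $u=u_0$, where $S=\{(t,st):0\le t<\infty\}$, $s$ is the velocity of the $\delta$-shock, $(\rho_0,u_0)(t,x)$ equals $(\rho_-,u_-)$ for $x<st$ and $(\rho_+,u_+)$ for $x>st$, and $$\langle w\delta_S,\varphi\rangle=\int_0^\infty w(t)\varphi(t,st)\sqrt{1+s^2}\,dt,\qquad\varphi\in C_0^\infty(\mathbb{R}^+\times\mathbb{R}).$$ The equations are understood in the sense of distributions, with $u$ taken equal to $s$ on $S$ in the singular part (so that $\rho u$ denotes $\rho_0u_0+s\,w\delta_S$); this gives the generalized Rankine-Hugoniot relation $$\frac{dx}{dt}=s,\qquad \frac{d\big(w(t)\sqrt{1+s^2}\big)}{dt}=s[\rho]-[\rho u-2\epsilon u],\qquad \frac{d\big(w(t)s\sqrt{1+s^2}\big)}{dt}=s[\rho u]-[\rho u^2-\epsilon u^2],$$ with $x(0)=0$, $w(0)=0$. The entropy condition $u_+<s<u_-$ is also required. The $\delta$-measures in the limit are supported on the line $x=\sigma t$, $t\ge0$. *)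

theory Defs
  imports "HOL-Analysis.Analysis"
begin

text \<open>
  Points of the half-plane are pairs (t, x), and a distribution is represented by its pairing
  with test functions. The test space is C0-infinity((0, infinity) x R), an element of which is
  identified with its extension by zero to the whole plane.
\<close>

primrec cont_diff :: "nat \<Rightarrow> ('a::real_normed_vector \<Rightarrow> 'b::real_normed_vector) \<Rightarrow> bool" where
  "cont_diff 0 f \<longleftrightarrow> continuous_on UNIV f"
| "cont_diff (Suc k) f \<longleftrightarrow>
     (\<forall>x. f differentiable (at x)) \<and> (\<forall>v. cont_diff k (\<lambda>x. frechet_derivative f (at x) v))"

definition test_function :: "(real \<times> real \<Rightarrow> real) \<Rightarrow> bool" where
  "test_function \<phi> \<longleftrightarrow>
     (\<forall>k. cont_diff k \<phi>) \<and>
     compact (closure {p. \<phi> p \<noteq> 0}) \<and> closure {p. \<phi> p \<noteq> 0} \<subseteq> {0<..} \<times> UNIV"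

type_synonym distribution = "(real \<times> real \<Rightarrow> real) \<Rightarrow> real"

definition partial_t :: "(real \<times> real \<Rightarrow> real) \<Rightarrow> real \<times> real \<Rightarrow> real" where
  "partial_t \<phi> p = frechet_derivative \<phi> (at p) (1, 0)"

definition partial_x :: "(real \<times> real \<Rightarrow> real) \<Rightarrow> real \<times> real \<Rightarrow> real" where
  "partial_x \<phi> p = frechet_derivative \<phi> (at p) (0, 1)"

definition distr_eq :: "distribution \<Rightarrow> distribution \<Rightarrow> bool" where
  "distr_eq D E \<longleftrightarrow> (\<forall>\<phi>. test_function \<phi> \<longrightarrow> D \<phi> = E \<phi>)"

definition distr_tendsto :: "('a \<Rightarrow> distribution) \<Rightarrow> distribution \<Rightarrow> 'a filter \<Rightarrow> bool" where
  "distr_tendsto D E F \<longleftrightarrow> (\<forall>\<phi>. test_function \<phi> \<longrightarrow> ((\<lambda>i. D i \<phi>) \<longlongrightarrow> E \<phi>) F)"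

text \<open>The equation D_t + E_x = 0 in the sense of distributions.\<close>

definition conservation_law :: "distribution \<Rightarrow> distribution \<Rightarrow> bool" where
  "conservation_law D E \<longleftrightarrow>
     (\<forall>\<phi>. test_function \<phi> \<longrightarrow> - D (partial_t \<phi>) - E (partial_x \<phi>) = 0)"

text \<open>
  The value b on the line x = s t itself is an arbitrary choice on a null set. At t = 0 the step
  function is the Riemann datum (a for x < 0, b for x > 0), whatever s is.
\<close>

definition step_function :: "real \<Rightarrow> real \<Rightarrow> real \<Rightarrow> real \<times> real \<Rightarrow> real" where
  "step_function s a b = (\<lambda>(t, x). if x < s * t then a else b)"

definition regular_distr :: "(real \<times> real \<Rightarrow> real) \<Rightarrow> distribution" where
  "regular_distr f \<phi> = (LINT p:{0<..} \<times> UNIV|lborel. f p * \<phi> p)"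

definition delta_distr :: "real \<Rightarrow> (real \<Rightarrow> real) \<Rightarrow> distribution" where
  "delta_distr s w \<phi> = (LINT t:{0..}|lborel. w t * \<phi> (t, s * t) * sqrt (1 + s\<^sup>2))"

definition step_plus_delta :: "real \<Rightarrow> real \<Rightarrow> real \<Rightarrow> (real \<Rightarrow> real) \<Rightarrow> distribution" where
  "step_plus_delta s a b w \<phi> = regular_distr (step_function s a b) \<phi> + delta_distr s w \<phi>"

text \<open>
  The fields of a delta-shock with left state (\<rho>m, um), right state (\<rho>p, up), speed s and
  weight w. In the products, u takes the value s on the singular part w delta_S of the density.
\<close>

definition mass_density :: "real \<Rightarrow> real \<Rightarrow> real \<Rightarrow> (real \<Rightarrow> real) \<Rightarrow> distribution" where
  "mass_density \<rho>m \<rho>p s w = step_plus_delta s \<rho>m \<rho>p w"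

definition velocity :: "real \<Rightarrow> real \<Rightarrow> real \<Rightarrow> distribution" where
  "velocity um up s = regular_distr (step_function s um up)"

definition velocity_sq :: "real \<Rightarrow> real \<Rightarrow> real \<Rightarrow> distribution" where
  "velocity_sq um up s = regular_distr (step_function s (um\<^sup>2) (up\<^sup>2))"

definition momentum :: "real \<Rightarrow> real \<Rightarrow> real \<Rightarrow> real \<Rightarrow> real \<Rightarrow> (real \<Rightarrow> real) \<Rightarrow> distribution" where
  "momentum \<rho>m um \<rho>p up s w = step_plus_delta s (\<rho>m * um) (\<rho>p * up) (\<lambda>t. s * w t)"

definition momentum_flux :: "real \<Rightarrow> real \<Rightarrow> real \<Rightarrow> real \<Rightarrow> real \<Rightarrow> (real \<Rightarrow> real) \<Rightarrow> distribution" where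
  "momentum_flux \<rho>m um \<rho>p up s w =
     step_plus_delta s (\<rho>m * um\<^sup>2) (\<rho>p * up\<^sup>2) (\<lambda>t. s\<^sup>2 * w t)"

text \<open>
  Test functions vanish near t = 0, so the initial data enter through the step functions, which
  jump along a line through the origin, and through the continuity of w with w(0) = 0. The
  generalized Rankine-Hugoniot relation is not assumed: it is a consequence of the two equations.
\<close>

definition delta_shock_solution ::
    "real \<Rightarrow> real \<Rightarrow> real \<Rightarrow> real \<Rightarrow> real \<Rightarrow> real \<Rightarrow> (real \<Rightarrow> real) \<Rightarrow> bool" where
  "delta_shock_solution \<epsilon> \<rho>m um \<rho>p up s w \<longleftrightarrow>
     continuous_on {0..} w \<and> w 0 = 0 \<and>
     conservation_law
       (mass_density \<rho>m \<rho>p s w)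
       (\<lambda>\<phi>. momentum \<rho>m um \<rho>p up s w \<phi> - 2 * \<epsilon> * velocity um up s \<phi>) \<and>
     conservation_law
       (momentum \<rho>m um \<rho>p up s w)
       (\<lambda>\<phi>. momentum_flux \<rho>m um \<rho>p up s w \<phi> - \<epsilon> * velocity_sq um up s \<phi>) \<and>
     up < s \<and> s < um"

end

theory Submission
  imports Defs
begin

text \<open>
  Each solution in the family turns out to be explicit, and the limit is then a continuity
  statement about explicit fields.

  Testing one conservation law with \<open>\<alpha>(t) \<beta>(x - s t)\<close>, where \<open>\<beta>\<close> equals 1 near 0, reduces it to
  one dimension: the step functions contribute a multiple of \<open>\<integral> \<alpha>\<close> given by their jumps, and the
  delta part contributes \<open>\<integral> w \<alpha>' sqrt (1 + s\<^sup>2)\<close>. Hence \<open>w sqrt (1 + s\<^sup>2)\<close> has a constant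
  distributional derivative, and since \<open>w\<close> is continuous with \<open>w 0 = 0\<close>, the du Bois-Reymond lemma
  makes it linear in \<open>t\<close>; this is \<open>rankine_hugoniot_weight\<close>. The
  second equation has the same shape with \<open>s w\<close> in the place of \<open>w\<close>, so the two slopes \<open>k\<close> and
  \<open>s k\<close> are both known in terms of the jumps. Their compatibility is a quadratic equation for \<open>s\<close>,
  and it can be arranged as
  \<open>(\<rho>p - \<epsilon>) (s - up)\<^sup>2 = (\<rho>m - \<epsilon>) (um - s)\<^sup>2\<close>. Under the entropy condition square roots may be taken,
  and \<open>s\<close> is the mean of \<open>up\<close> and \<open>um\<close> with weights \<open>sqrt (\<rho>p - \<epsilon>)\<close> and \<open>sqrt (\<rho>m - \<epsilon>)\<close>
  (\<open>delta_shock_weight_and_speed\<close>). So \<open>s \<epsilon>\<close> tends to \<open>\<sigma>\<close>.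

  A step function with a jump along \<open>x = s t\<close> and a delta function with a linear weight on that line
  depend continuously on \<open>s\<close> and on the slope, as distributions, by dominated convergence
  (\<open>step_plus_delta_tendsto\<close>). All fields therefore converge. Partial derivatives of test functions
  are test functions, so the conservation laws pass to the limit too (\<open>conservation_law_limit\<close>),
  and the limit is a delta-shock solution without a second computation.
\<close>

section \<open>Smooth functions and a smooth step\<close>

lemma cont_diff_continuous: "cont_diff k f \<Longrightarrow> continuous_on UNIV f"
  by (cases k) (auto intro!: differentiable_imp_continuous_on simp: differentiable_on_def
      differentiable_at_withinI)

lemma cont_diff_Suc_D: "cont_diff (Suc k) f \<Longrightarrow> cont_diff k f"
proof (induction k arbitrary: f)
  case 0
  then show ?case using cont_diff_continuous by fastforce
qed auto

lemma cont_diff_SucI: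
  assumes "\<And>x. (f has_derivative f' x) (at x)" and "\<And>v. cont_diff k (\<lambda>x. f' x v)"
  shows "cont_diff (Suc k) f"
proof -
  have "frechet_derivative f (at x) = f' x" for x
    using frechet_derivative_at[OF assms(1)] by simp
  then show ?thesis
    using assms by (auto simp: differentiable_def)
qed

text \<open>
  The induction proofs below work with an arbitrary family of derivatives instead of
  \<^const>\<open>frechet_derivative\<close>, so that the calculus rules of the library apply directly.
\<close>
lemma cont_diff_Suc_E:
  assumes "cont_diff (Suc k) f"
  obtains f' where "\<And>x. (f has_derivative f' x) (at x)" "\<And>v. cont_diff k (\<lambda>x. f' x v)"
  using assms frechet_derivative_works by (auto intro!: that[of "\<lambda>x. frechet_derivative f (at x)"])

lemma cont_diff_const: "cont_diff k (\<lambda>x. c)"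
proof (induction k arbitrary: c)
  case (Suc k)
  show ?case by (rule cont_diff_SucI[where f' = "\<lambda>x v. 0"]) (auto intro: Suc)
qed auto

lemma cont_diff_add: "cont_diff k f \<Longrightarrow> cont_diff k g \<Longrightarrow> cont_diff k (\<lambda>x. f x + g x)"
proof (induction k arbitrary: f g)
  case 0
  then show ?case by (auto intro: continuous_intros)
next
  case (Suc k)
  obtain f' g' where "\<And>x. (f has_derivative f' x) (at x)" "\<And>v. cont_diff k (\<lambda>x. f' x v)"
    "\<And>x. (g has_derivative g' x) (at x)" "\<And>v. cont_diff k (\<lambda>x. g' x v)"
    using Suc.prems cont_diff_Suc_E by metis
  then show ?case
    by (intro cont_diff_SucI[where f' = "\<lambda>x v. f' x v + g' x v"] Suc.IH)
       (auto intro!: has_derivative_add)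
qed

lemma cont_diff_mult:
  fixes f g :: "'a::real_normed_vector \<Rightarrow> real"
  shows "cont_diff k f \<Longrightarrow> cont_diff k g \<Longrightarrow> cont_diff k (\<lambda>x. f x * g x)"
proof (induction k arbitrary: f g)
  case 0
  then show ?case by (auto intro: continuous_intros)
next
  case (Suc k)
  obtain f' g' where d: "\<And>x. (f has_derivative f' x) (at x)" "\<And>v. cont_diff k (\<lambda>x. f' x v)"
    "\<And>x. (g has_derivative g' x) (at x)" "\<And>v. cont_diff k (\<lambda>x. g' x v)"
    using Suc.prems cont_diff_Suc_E by metis
  show ?case
    by (rule cont_diff_SucI[OF has_derivative_mult[OF d(1,3)]])
       (intro cont_diff_add Suc.IH d Suc.prems[THEN cont_diff_Suc_D])
qed

lemma cont_diff_diff: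
  fixes f g :: "'a::real_normed_vector \<Rightarrow> real"
  assumes "cont_diff k f" "cont_diff k g"
  shows "cont_diff k (\<lambda>x. f x - g x)"
  using cont_diff_add[OF assms(1) cont_diff_mult[OF cont_diff_const[of k "-1"] assms(2)]] by simp

lemma cont_diff_inverse:
  fixes f :: "'a::real_normed_vector \<Rightarrow> real"
  assumes "\<And>x. f x \<noteq> 0"
  shows "cont_diff k f \<Longrightarrow> cont_diff k (\<lambda>x. inverse (f x))"
proof (induction k)
  case 0
  then show ?case using assms by (auto intro!: continuous_intros)
next
  case (Suc k)
  obtain f' where d: "\<And>x. (f has_derivative f' x) (at x)" "\<And>v. cont_diff k (\<lambda>x. f' x v)"
    using Suc.prems cont_diff_Suc_E by metis
  have inv: "cont_diff k (\<lambda>x. inverse (f x))"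
    using Suc.IH Suc.prems cont_diff_Suc_D by blast
  have "cont_diff k (\<lambda>x. -1 * (inverse (f x) * f' x v * inverse (f x)))" for v
    by (intro cont_diff_mult cont_diff_const inv d)
  then show ?case
    by (intro cont_diff_SucI[OF Deriv.has_derivative_inverse[OF assms d(1)]]) simp
qed

text \<open>
  Precomposition with an affine map commutes with differentiation up to the constant direction
  \<open>L v\<close>, so the induction hypothesis applies to each directional derivative.
\<close>
lemma cont_diff_compose_affine:
  assumes "bounded_linear L"
  shows "cont_diff k f \<Longrightarrow> cont_diff k (\<lambda>x. f (L x + c))"
proof (induction k arbitrary: f)
  case 0
  have "continuous_on UNIV (\<lambda>x. L x + c)"
    by (intro continuous_intros linear_continuous_on assms)
  with 0 show ?case
    by (auto intro: continuous_on_compose2[of UNIV f])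
next
  case (Suc k)
  obtain f' where d: "\<And>x. (f has_derivative f' x) (at x)" "\<And>v. cont_diff k (\<lambda>x. f' x v)"
    using Suc.prems cont_diff_Suc_E by metis
  have "((\<lambda>x. f (L x + c)) has_derivative (\<lambda>v. f' (L x + c) (L v))) (at x)" for x
  proof -
    have "((\<lambda>x. L x + c) has_derivative L) (at x)"
      using bounded_linear_imp_has_derivative[OF assms] has_derivative_add_const by blast
    from has_derivative_compose[OF this d(1)] show ?thesis .
  qed
  then show ?case
    by (rule cont_diff_SucI) (intro Suc.IH d)
qed

text \<open>
  The functions \<open>p(1/x) exp(-1/x)\<close>, extended by zero to \<open>x \<le> 0\<close>. Carrying the polynomial makes
  the family closed under differentiation, hence each member smooth.
\<close>
definition flat_exp :: "real poly \<Rightarrow> real \<Rightarrow> real" where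
  "flat_exp p x = (if 0 < x then poly p (1 / x) * exp (- (1 / x)) else 0)"

lemma tendsto_poly_exp_neg: "((\<lambda>y::real. poly p y * exp (- y)) \<longlongrightarrow> 0) at_top"
proof -
  have "((\<lambda>y. \<Sum>i\<le>degree p. coeff p i * (y ^ i / exp y)) \<longlongrightarrow> (\<Sum>i\<le>degree p. coeff p i * 0)) at_top"
    by (intro tendsto_intros tendsto_power_div_exp_0)
  moreover have "(\<lambda>y::real. poly p y * exp (- y)) = (\<lambda>y. \<Sum>i\<le>degree p. coeff p i * (y ^ i / exp y))"
    by (auto simp: poly_altdef sum_distrib_right sum_divide_distrib exp_minus divide_inverse mult.assoc)
  ultimately show ?thesis by simp
qed

lemma flat_exp_has_derivative:
  "(flat_exp p has_real_derivative flat_exp ([:0, 0, 1:] * (p - pderiv p)) x) (at x)"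
proof (cases x "0::real" rule: linorder_cases)
  case less
  have "((\<lambda>_. 0) has_real_derivative 0) (at x)" by simp
  then have "(flat_exp p has_real_derivative 0) (at x)"
    by (rule has_field_derivative_transform_within_open[where S = "{..<0}"])
       (use less in \<open>auto simp: flat_exp_def\<close>)
  with less show ?thesis by (simp add: flat_exp_def)
next
  case equal
  have "((\<lambda>y::real. poly ([:0, 1:] * p) y * exp (- y)) \<longlongrightarrow> 0) at_top"
    by (rule tendsto_poly_exp_neg)
  from filterlim_compose[OF this filterlim_inverse_at_top_right]
  have "((\<lambda>h. flat_exp p h / h) \<longlongrightarrow> 0) (at_right 0)"
    by (rule Lim_transform_eventually)
       (auto simp: eventually_at_right_less flat_exp_def field_simps eventually_at_filter)
  moreover have "((\<lambda>h. flat_exp p h / h) \<longlongrightarrow> 0) (at_left 0)"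
    by (rule Lim_transform_eventually[OF tendsto_const])
       (auto simp: flat_exp_def eventually_at_filter)
  ultimately have "((\<lambda>h. flat_exp p h / h) \<longlongrightarrow> 0) (at 0)"
    by (rule filterlim_split_at[rotated])
  with equal show ?thesis
    by (simp add: DERIV_def flat_exp_def)
next
  case greater
  have g: "((\<lambda>y. poly p y * exp (- y)) has_real_derivative
          (poly (pderiv p) y - poly p y) * exp (- y)) (at y)" for y
    by (auto intro!: derivative_eq_intros simp: algebra_simps)
  have "((\<lambda>x. 1 / x) has_real_derivative - (1 / x\<^sup>2)) (at x)"
    using greater by (auto intro!: derivative_eq_intros simp: power2_eq_square)
  from DERIV_chain2[OF g this]
  have "((\<lambda>x. poly p (1 / x) * exp (- (1 / x))) has_real_derivative
          poly ([:0, 0, 1:] * (p - pderiv p)) (1 / x) * exp (- (1 / x))) (at x)"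
    by (rule DERIV_cong) (simp add: power2_eq_square algebra_simps)
  then have "(flat_exp p has_real_derivative
          poly ([:0, 0, 1:] * (p - pderiv p)) (1 / x) * exp (- (1 / x))) (at x)"
    by (rule has_field_derivative_transform_within_open[where S = "{0<..}"])
       (use greater in \<open>auto simp: flat_exp_def\<close>)
  with greater show ?thesis by (simp add: flat_exp_def)
qed

lemma cont_diff_flat_exp: "cont_diff k (flat_exp p)"
proof (induction k arbitrary: p)
  case 0
  show ?case
    using DERIV_isCont[OF flat_exp_has_derivative[of p]] by (auto intro: continuous_at_imp_continuous_on)
next
  case (Suc k)
  show ?case
    by (rule cont_diff_SucI[OF flat_exp_has_derivative[unfolded has_field_derivative_def]])
       (intro cont_diff_mult cont_diff_const Suc)
qed

text \<open>
  The quotient \<open>f(x) / (f(x) + f(1 - x))\<close> with \<open>f(x) = exp(-1/x)\<close>, whose denominator never vanishes.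
  Every cutoff used later is a difference of two rescaled and translated copies of this step.
\<close>
lemma smooth_step:
  obtains H :: "real \<Rightarrow> real"
  where "\<And>k. cont_diff k H" "\<And>x. x \<le> 0 \<Longrightarrow> H x = 0" "\<And>x. 1 \<le> x \<Longrightarrow> H x = 1"
proof
  let ?f = "flat_exp 1"
  let ?H = "\<lambda>x. ?f x * inverse (?f x + ?f (- x + 1))"
  have pos: "?f x + ?f (- x + 1) \<noteq> 0" for x
    by (cases "0 < x"; cases "x < 1") (auto simp: flat_exp_def add_nonneg_eq_0_iff)
  show "cont_diff k ?H" for k
    by (intro cont_diff_mult cont_diff_inverse cont_diff_add cont_diff_flat_exp pos
        cont_diff_compose_affine bounded_linear_minus bounded_linear_ident)
  show "?H x = 0" if "x \<le> 0" for x using that by (simp add: flat_exp_def)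
  show "?H x = 1" if "1 \<le> x" for x using that pos[of x] by (simp add: flat_exp_def)
qed

lemma cont_diff_real_derivative:
  fixes f :: "real \<Rightarrow> real"
  assumes "\<And>k. cont_diff k f"
  obtains f' where "\<And>x. (f has_real_derivative f' x) (at x)" "\<And>k. cont_diff k f'"
proof
  let ?f' = "\<lambda>x. frechet_derivative f (at x) 1"
  have *: "f differentiable at x" "cont_diff k ?f'" for x k
    using assms[of "Suc k"] by auto
  show "(f has_real_derivative ?f' x) (at x)" for x
  proof -
    have d: "(f has_derivative frechet_derivative f (at x)) (at x)"
      using * frechet_derivative_works by blast
    have "frechet_derivative f (at x) = (*) (?f' x)"
    proof
      fix v
      show "frechet_derivative f (at x) v = ?f' x * v"
        using linear_scale[OF has_derivative_linear[OF d], of v 1] by (simp add: mult.commute)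
    qed
    with d show ?thesis
      unfolding has_field_derivative_def by (rule has_derivative_eq_rhs)
  qed
  show "cont_diff k ?f'" for k using * by blast
qed

section \<open>Integrals against compactly supported functions\<close>

lemma derivative_zero_where_constant:
  fixes f :: "real \<Rightarrow> real"
  assumes "(f has_real_derivative d) (at x)" and "open S" "x \<in> S" "\<And>y. y \<in> S \<Longrightarrow> f y = c"
  shows "d = 0"
  using has_field_derivative_transform_within_open[OF assms(1-3), of "\<lambda>_. c"] assms(4)
    DERIV_unique[OF _ DERIV_const] by blast

lemma derivative_outside_support:
  fixes f :: "real \<Rightarrow> real"
  assumes "(f has_real_derivative d) (at x)" "\<And>x. x \<notin> {l..r} \<Longrightarrow> f x = 0" "x \<notin> {l..r}"
  shows "d = 0"
  using derivative_zero_where_constant[OF assms(1), of "- {l..r}" 0] assms(2,3) by auto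

text \<open>
  The fundamental theorem of calculus on the two half-lines. For \<open>a = b\<close> it says that the derivative
  of a compactly supported function has integral zero.
\<close>
lemma integral_step_times_derivative:
  fixes f f' :: "real \<Rightarrow> real"
  assumes f: "\<And>x. (f has_real_derivative f' x) (at x)" and f': "continuous_on UNIV f'"
    and supp: "\<And>x. x \<notin> {l..r} \<Longrightarrow> f x = 0"
  shows "(LINT x|lborel. (if x < 0 then a else b) * f' x) = (a - b) * f 0"
proof -
  define R where "R = \<bar>l\<bar> + \<bar>r\<bar> + 1"
  have R: "0 \<le> R" "f R = 0" "f (- R) = 0" unfolding R_def by (auto intro!: supp)
  have out: "f' x = 0" if "x \<notin> {- R..R}" for x
    by (rule derivative_outside_support[OF f supp]) (use that in \<open>auto simp: R_def\<close>)
  have [measurable]: "f' \<in> borel_measurable borel"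
    using f' by (rule borel_measurable_continuous_onI)
  have cont: "isCont f' x" for x
    using f' continuous_on_eq_continuous_at open_UNIV by blast
  have "has_bochner_integral lborel
          (\<lambda>x. a * (f' x * indicator {-R..0} x) + b * (f' x * indicator {0..R} x))
          (a * (f 0 - f (-R)) + b * (f R - f 0))"
    using R by (intro has_bochner_integral_add has_bochner_integral_mult_right
                      has_bochner_integral_FTC_Icc_real f cont) auto
  then have "(LINT x|lborel. a * (f' x * indicator {-R..0} x) + b * (f' x * indicator {0..R} x))
               = (a - b) * f 0"
    using R by (simp add: has_bochner_integral_iff algebra_simps)
  moreover have "(LINT x|lborel. (if x < 0 then a else b) * f' x) =
                 (LINT x|lborel. a * (f' x * indicator {-R..0} x) + b * (f' x * indicator {0..R} x))"
  proof (rule integral_cong_AE)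
    show "AE x in lborel. (if x < 0 then a else b) * f' x =
            a * (f' x * indicator {-R..0} x) + b * (f' x * indicator {0..R} x)"
      using AE_lborel_singleton[of "0::real"]
      by eventually_elim (auto simp: indicator_def out)
  qed measurable
  ultimately show ?thesis by simp
qed

lemma integrable_bounded_mult_compact_support:
  fixes f g :: "'a::euclidean_space \<Rightarrow> real"
  assumes f: "f \<in> borel_measurable borel" "\<And>x. \<bar>f x\<bar> \<le> B"
    and g: "continuous_on UNIV g" and K: "compact K" "\<And>x. x \<notin> K \<Longrightarrow> g x = 0"
  shows "integrable lborel (\<lambda>x. f x * g x)"
proof (rule Bochner_Integration.integrable_bound)
  have "integrable lborel (\<lambda>x. indicator K x *\<^sub>R g x)"
    by (rule borel_integrable_compact) (use K continuous_on_subset[OF g] in auto)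
  also have "(\<lambda>x. indicator K x *\<^sub>R g x) = g"
    using K by (auto simp: indicator_def fun_eq_iff)
  finally show "integrable lborel (\<lambda>x. B * g x)" by simp
  have [measurable]: "g \<in> borel_measurable borel"
    using g by (rule borel_measurable_continuous_onI)
  show "(\<lambda>x. f x * g x) \<in> borel_measurable lborel" using f(1) by simp
  have "\<bar>f x\<bar> * \<bar>g x\<bar> \<le> \<bar>B\<bar> * \<bar>g x\<bar>" for x
    by (rule mult_right_mono) (use f(2)[of x] in auto)
  then show "AE x in lborel. norm (f x * g x) \<le> norm (B * g x)"
    by (simp add: abs_mult)
qed

lemma set_integrable_mult_compact_support:
  fixes g k :: "real \<Rightarrow> real"
  assumes g: "continuous_on {0..} g" and k: "continuous_on UNIV k"
    and supp: "\<And>t. t \<notin> {l..r} \<Longrightarrow> k t = 0" and "0 \<le> l"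
  shows "set_integrable lborel {0..} (\<lambda>t. g t * k t)"
proof -
  have "continuous_on {l..r} (\<lambda>t. g t * k t)"
    using \<open>0 \<le> l\<close> by (intro continuous_on_mult continuous_on_subset[OF g] continuous_on_subset[OF k]) auto
  from borel_integrable_compact[OF compact_Icc this]
  show ?thesis
    unfolding set_integrable_def
    by (rule Bochner_Integration.integrable_cong[THEN iffD1, rotated 2])
       (use supp \<open>0 \<le> l\<close> in \<open>auto simp: indicator_def\<close>)
qed

section \<open>A du Bois-Reymond lemma on the half-line\<close>

text \<open>
  The kernels \<open>N h(N (t - a))\<close> form an approximate identity at \<open>a\<close> from the right. The sign of \<open>h\<close>
  does not matter, since \<open>\<bar>h\<bar>\<close> supplies the dominating function after rescaling.
\<close>
lemma shrinking_average_tendsto: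
  fixes g h :: "real \<Rightarrow> real"
  assumes g: "continuous_on {0..} g" and h: "continuous_on UNIV h"
    and supp: "\<And>y. y \<notin> {0..1} \<Longrightarrow> h y = 0" and h1: "(LINT y|lborel. h y) = 1" and "0 < a"
  shows "(\<lambda>n. LINT t:{0..}|lborel. g t * (real (Suc n) * h (real (Suc n) * (t - a)))) \<longlonglongrightarrow> g a"
proof -
  define G where "G t = indicator {0..} t *\<^sub>R g t" for t
  have [measurable]: "G \<in> borel_measurable borel"
    unfolding G_def by (rule borel_measurable_continuous_on_indicator[OF _ g]) simp
  have [measurable]: "h \<in> borel_measurable borel"
    using h by (rule borel_measurable_continuous_onI)
  have "compact (g ` {a..a + 1})"
    by (intro compact_continuous_image continuous_on_subset[OF g]) (use \<open>0 < a\<close> in auto)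
  from compact_imp_bounded[OF this]
  obtain M where M: "\<And>t. t \<in> {a..a + 1} \<Longrightarrow> \<bar>g t\<bar> \<le> M"
    unfolding bounded_iff by (metis imageI real_norm_def)
  have "(LINT t:{0..}|lborel. g t * (real (Suc n) * h (real (Suc n) * (t - a)))) =
        (LINT y|lborel. G (a + y / real (Suc n)) * h y)" for n
  proof -
    have "(LINT t:{0..}|lborel. g t * (real (Suc n) * h (real (Suc n) * (t - a)))) =
          (LINT t|lborel. real (Suc n) * (G t * h (real (Suc n) * (t - a))))"
      unfolding set_lebesgue_integral_def G_def
      by (rule Bochner_Integration.integral_cong) auto
    also have "\<dots> = real (Suc n) * (LINT t|lborel. G t * h (real (Suc n) * (t - a)))"
      by simp
    also have "(LINT t|lborel. G t * h (real (Suc n) * (t - a))) =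
        1 / real (Suc n) * (LINT y|lborel. G (a + y / real (Suc n)) * h y)"
      by (subst lborel_integral_real_affine[where c = "1 / real (Suc n)" and t = a])
         (simp_all del: of_nat_Suc)
    finally show ?thesis by (simp del: of_nat_Suc)
  qed
  moreover have "(\<lambda>n. LINT y|lborel. G (a + y / real (Suc n)) * h y) \<longlonglongrightarrow> (LINT y|lborel. g a * h y)"
  proof (rule integral_dominated_convergence)
    have "integrable lborel (\<lambda>y. 1 * \<bar>h y\<bar>)"
      by (rule integrable_bounded_mult_compact_support[where K = "{0..1}" and B = 1])
         (use h supp in \<open>auto intro: continuous_intros\<close>)
    then show "integrable lborel (\<lambda>y. M * \<bar>h y\<bar>)" by simp
    show "AE y in lborel. (\<lambda>n. G (a + y / real (Suc n)) * h y) \<longlonglongrightarrow> g a * h y"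
    proof (intro AE_I2 tendsto_mult tendsto_const)
      fix y :: real
      have "isCont g a"
        using g \<open>0 < a\<close> continuous_on_interior[of "{0..}" g a] by simp
      moreover have "(\<lambda>n. a + y * inverse (real (Suc n))) \<longlonglongrightarrow> a + y * 0"
        by (intro tendsto_intros LIMSEQ_inverse_real_of_nat)
      then have lim: "(\<lambda>n. a + y / real (Suc n)) \<longlonglongrightarrow> a"
        by (simp add: divide_inverse)
      ultimately have "(\<lambda>n. g (a + y / real (Suc n))) \<longlonglongrightarrow> g a"
        by (rule isCont_tendsto_compose)
      moreover have "eventually (\<lambda>n. 0 < a + y / real (Suc n)) sequentially"
        using order_tendstoD(1)[OF lim \<open>0 < a\<close>] .
      then have "eventually (\<lambda>n. g (a + y / real (Suc n)) = G (a + y / real (Suc n))) sequentially"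
        by eventually_elim (simp add: G_def)
      ultimately show "(\<lambda>n. G (a + y / real (Suc n))) \<longlonglongrightarrow> g a"
        by (rule Lim_transform_eventually)
    qed
    show "AE y in lborel. norm (G (a + y / real (Suc n)) * h y) \<le> M * \<bar>h y\<bar>" for n
    proof (intro AE_I2)
      fix y
      show "norm (G (a + y / real (Suc n)) * h y) \<le> M * \<bar>h y\<bar>"
      proof (cases "y \<in> {0..1}")
        case True
        then have "0 \<le> y / real (Suc n)" "y / real (Suc n) \<le> 1"
          by (auto simp: divide_le_eq simp del: of_nat_Suc)
        then have "\<bar>G (a + y / real (Suc n))\<bar> \<le> M"
          using M[of "a + y / real (Suc n)"] \<open>0 < a\<close> by (auto simp: G_def)
        then show ?thesis by (simp add: abs_mult mult_right_mono del: of_nat_Suc)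
      qed (simp add: supp)
    qed
  qed measurable
  ultimately show ?thesis using h1 by simp
qed

text \<open>
  The test function \<open>\<alpha>\<close> rises from 0 to 1 just after \<open>a\<close> and falls back just after \<open>b\<close>, so its
  derivative is the difference of two approximate identities. In the limit \<open>\<integral> g \<alpha>' = 0\<close> becomes
  \<open>g a = g b\<close>.
\<close>
lemma du_bois_reymond:
  fixes g :: "real \<Rightarrow> real"
  assumes g: "continuous_on {0..} g"
    and orth: "\<And>\<alpha> \<alpha>' l r. \<lbrakk>0 < l; \<And>k. cont_diff k \<alpha>; \<And>t. (\<alpha> has_real_derivative \<alpha>' t) (at t);
         \<And>t. t \<notin> {l..r} \<Longrightarrow> \<alpha> t = 0\<rbrakk> \<Longrightarrow> (LINT t:{0..}|lborel. g t * \<alpha>' t) = 0"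
    and "0 < a" "a < b"
  shows "g a = g b"
proof -
  obtain H :: "real \<Rightarrow> real" where H: "\<And>k. cont_diff k H" "\<And>x. x \<le> 0 \<Longrightarrow> H x = 0" "\<And>x. 1 \<le> x \<Longrightarrow> H x = 1"
    using smooth_step by blast
  obtain h where h: "\<And>x. (H has_real_derivative h x) (at x)" "\<And>k. cont_diff k h"
    using cont_diff_real_derivative[OF H(1)] by blast
  have h_cont: "continuous_on UNIV h" using h(2)[of 0] by simp
  have supp: "h y = 0" if "y \<notin> {0..1}" for y
    using derivative_zero_where_constant[OF h(1)[of y], of "{..<0}" 0]
      derivative_zero_where_constant[OF h(1)[of y], of "{1<..}" 1] that H by fastforce
  have "has_bochner_integral lborel (\<lambda>y. h y * indicator {0..1} y) (H 1 - H 0)"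
    by (rule has_bochner_integral_FTC_Icc_real)
       (use h h_cont in \<open>auto simp: continuous_on_eq_continuous_at\<close>)
  moreover have "(\<lambda>y. h y * indicator {0..1} y) = h"
    using supp by (auto simp: indicator_def fun_eq_iff)
  ultimately have h1: "(LINT y|lborel. h y) = 1"
    using H by (simp add: has_bochner_integral_iff)
  \<comment> \<open>The average of \<open>g\<close> over a window of width \<open>1 / (n + 1)\<close> to the right of \<open>c\<close>.\<close>
  define J where "J c n = (LINT t:{0..}|lborel. g t * (real (Suc n) * h (real (Suc n) * (t - c))))" for c n
  have lim: "J c \<longlonglongrightarrow> g c" if "0 < c" for c
    unfolding J_def by (rule shrinking_average_tendsto[OF g h_cont supp h1 that])
  have "J a n = J b n" for n
  proof -
    define N where "N = real (Suc n)"
    have "1 \<le> N" by (simp add: N_def)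
    let ?k = "\<lambda>c t. N * h (N * (t - c))"
    have int: "set_integrable lborel {0..} (\<lambda>t. g t * ?k c t)" if "0 < c" for c
    proof (rule set_integrable_mult_compact_support[OF g, where l = c and r = "c + 1"])
      show "continuous_on UNIV (?k c)"
        by (intro continuous_intros continuous_on_compose2[OF h_cont]) auto
      show "?k c t = 0" if "t \<notin> {c..c + 1}" for t
      proof -
        have "N * (t - c) \<notin> {0..1}"
        proof (cases "t < c")
          case True
          then show ?thesis using \<open>1 \<le> N\<close> by (simp add: zero_le_mult_iff)
        next
          case False
          then have "1 < t - c" using that by simp
          then have "1 * 1 < N * (t - c)" using \<open>1 \<le> N\<close> by (intro mult_le_less_imp_less) auto
          then show ?thesis by simp
        qed
        then show ?thesis by (simp add: supp)
      qed
    qed (use that in simp)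
    let ?\<alpha> = "\<lambda>t. H (N * t + - (N * a)) - H (N * t + - (N * b))"
    have "(LINT t:{0..}|lborel. g t * (?k a t - ?k b t)) = 0"
    proof (rule orth[where \<alpha> = ?\<alpha>, OF \<open>0 < a\<close>])
      show "cont_diff k ?\<alpha>" for k
        by (intro cont_diff_diff cont_diff_compose_affine bounded_linear_mult_right H)
      have "((\<lambda>t. H (N * t + - (N * c))) has_real_derivative ?k c t) (at t)" for c t
      proof -
        have "((\<lambda>t. N * t + - (N * c)) has_real_derivative N) (at t)"
          by (auto intro!: derivative_eq_intros)
        from DERIV_chain2[OF h(1) this] show ?thesis by (simp add: algebra_simps)
      qed
      then show "(?\<alpha> has_real_derivative ?k a t - ?k b t) (at t)" for t
        by (intro DERIV_diff)
      show "?\<alpha> t = 0" if "t \<notin> {a..b + 1}" for t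
      proof (cases "t < a")
        case True
        then have "N * (t - a) \<le> 0" "N * (t - b) \<le> 0"
          using \<open>1 \<le> N\<close> \<open>a < b\<close> by (auto simp: mult_le_0_iff)
        then show ?thesis using H by (simp add: algebra_simps)
      next
        case False
        then have "1 * 1 \<le> N * (t - a)" "1 * 1 \<le> N * (t - b)"
          using that \<open>1 \<le> N\<close> \<open>a < b\<close> by (intro mult_mono; simp)+
        then show ?thesis using H by (simp add: algebra_simps)
      qed
    qed
    moreover have "(LINT t:{0..}|lborel. g t * (?k a t - ?k b t)) = J a n - J b n"
      unfolding J_def N_def[symmetric] right_diff_distrib[of "g _" "N * _"]
      by (rule set_integral_diff) (use int \<open>0 < a\<close> \<open>a < b\<close> in auto)
    ultimately show ?thesis by simp
  qed
  then have "J a = J b" by blast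
  with lim[of a] lim[of b] \<open>0 < a\<close> \<open>a < b\<close> show ?thesis
    by (metis LIMSEQ_unique order.strict_trans)
qed

section \<open>Pairing step functions with sheared products\<close>

lemma borel_measurable_step_function [measurable]: "step_function s a b \<in> borel_measurable borel"
proof -
  have "{z::real \<times> real. snd z < s * fst z} \<in> sets borel"
    by (intro borel_open open_Collect_less continuous_intros)
  then have "(\<lambda>z::real \<times> real. if z \<in> {z. snd z < s * fst z} then a else b) \<in> borel_measurable borel"
    by (intro measurable_If_set) auto
  also have "(\<lambda>z::real \<times> real. if z \<in> {z. snd z < s * fst z} then a else b) = step_function s a b"
    by (auto simp: step_function_def)
  finally show ?thesis .
qed

lemma step_function_bound: "\<bar>step_function s a b z\<bar> \<le> \<bar>a\<bar> + \<bar>b\<bar>"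
  by (auto simp: step_function_def split: prod.split)

lemma regular_distr_eq_lborel:
  assumes "\<And>z. fst z \<le> 0 \<Longrightarrow> \<phi> z = 0"
  shows "regular_distr f \<phi> = (LINT z|lborel. f z * \<phi> z)"
  unfolding regular_distr_def set_lebesgue_integral_def
proof (rule Bochner_Integration.integral_cong)
  show "indicator ({0<..} \<times> UNIV) z *\<^sub>R (f z * \<phi> z) = f z * \<phi> z" for z
    using assms[of z] by (cases z) (auto simp: indicator_def not_less)
qed simp

text \<open>
  A product in the coordinates \<open>t\<close> and \<open>y = x - s t\<close>, in which the jump line \<open>x = s t\<close> is \<open>y = 0\<close>.
  Integrals over the half-plane then factor.
\<close>
definition shear_product :: "real \<Rightarrow> (real \<Rightarrow> real) \<Rightarrow> (real \<Rightarrow> real) \<Rightarrow> real \<times> real \<Rightarrow> real" where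
  "shear_product s \<alpha> \<beta> z = \<alpha> (fst z) * \<beta> (snd z - s * fst z)"

lemma continuous_shear_product:
  assumes "continuous_on UNIV \<alpha>" "continuous_on UNIV \<beta>"
  shows "continuous_on UNIV (shear_product s \<alpha> \<beta>)"
  unfolding shear_product_def
  by (intro continuous_intros continuous_on_compose2[OF assms(1)] continuous_on_compose2[OF assms(2)]) auto

lemma shear_product_support:
  assumes "\<And>t. t \<notin> {l..r} \<Longrightarrow> \<alpha> t = 0" "\<And>y. y \<notin> {l'..r'} \<Longrightarrow> \<beta> y = 0"
  shows "z \<notin> (\<lambda>(t, y). (t, y + s * t)) ` ({l..r} \<times> {l'..r'}) \<Longrightarrow> shear_product s \<alpha> \<beta> z = 0"
  using assms
  by (cases z) (auto simp: shear_product_def image_iff split_beta Bex_def, metis add.commute add_diff_cancel_left' diff_add_cancel)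

lemma compact_shear_image: "compact ((\<lambda>(t, y). (t, y + s * t)) ` ({l..r::real} \<times> {l'..r'}))"
  by (intro compact_continuous_image compact_Times compact_Icc)
     (auto simp: split_beta intro!: continuous_intros)

text \<open>Fubini, with the inner variable shifted by \<open>s t\<close>; the shear has Jacobian 1.\<close>
lemma regular_distr_shear_product:
  assumes \<alpha>: "continuous_on UNIV \<alpha>" "\<And>t. t \<notin> {l..r} \<Longrightarrow> \<alpha> t = 0" "0 < l"
    and \<beta>: "continuous_on UNIV \<beta>" "\<And>y. y \<notin> {l'..r'} \<Longrightarrow> \<beta> y = 0"
  shows "integrable lborel (\<lambda>z. step_function s a b z * shear_product s \<alpha> \<beta> z)"
    and "regular_distr (step_function s a b) (shear_product s \<alpha> \<beta>) =
           (LINT t|lborel. \<alpha> t) * (LINT y|lborel. (if y < 0 then a else b) * \<beta> y)"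
proof -
  let ?f = "\<lambda>z. step_function s a b z * shear_product s \<alpha> \<beta> z"
  show int: "integrable lborel ?f"
    by (rule integrable_bounded_mult_compact_support[OF borel_measurable_step_function
          step_function_bound continuous_shear_product compact_shear_image shear_product_support])
       (use assms in auto)
  have "regular_distr (step_function s a b) (shear_product s \<alpha> \<beta>) = (LINT z|lborel. ?f z)"
    by (rule regular_distr_eq_lborel) (use \<alpha> in \<open>auto simp: shear_product_def\<close>)
  also have "\<dots> = (LINT t|lborel. LINT x|lborel. ?f (t, x))"
    using lborel_pair.integral_fst'[of ?f] int by (simp add: lborel_prod)
  finally have fubini: "regular_distr (step_function s a b) (shear_product s \<alpha> \<beta>) = \<dots>" .
  have inner: "(LINT x|lborel. ?f (t, x)) = \<alpha> t * (LINT y|lborel. (if y < 0 then a else b) * \<beta> y)" for t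
  proof -
    have "(LINT x|lborel. ?f (t, x)) = (LINT y|lborel. ?f (t, s * t + 1 * y))"
      by (subst lborel_integral_real_affine[where c = 1 and t = "s * t"]) simp_all
    also have "\<dots> = (LINT y|lborel. \<alpha> t * ((if y < 0 then a else b) * \<beta> y))"
      by (rule Bochner_Integration.integral_cong) (auto simp: step_function_def shear_product_def)
    finally show ?thesis by simp
  qed
  show "regular_distr (step_function s a b) (shear_product s \<alpha> \<beta>) =
           (LINT t|lborel. \<alpha> t) * (LINT y|lborel. (if y < 0 then a else b) * \<beta> y)"
    unfolding fubini inner by simp
qed

lemma partial_derivatives_shear_product:
  assumes \<alpha>: "\<And>t. (\<alpha> has_real_derivative \<alpha>' t) (at t)"
    and \<beta>: "\<And>y. (\<beta> has_real_derivative \<beta>' y) (at y)"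
  shows "partial_t (shear_product s \<alpha> \<beta>) =
           (\<lambda>z. shear_product s \<alpha>' \<beta> z - s * shear_product s \<alpha> \<beta>' z)"
    and "partial_x (shear_product s \<alpha> \<beta>) = shear_product s \<alpha> \<beta>'"
proof -
  have "(shear_product s \<alpha> \<beta> has_derivative (\<lambda>v. \<alpha> (fst z) * (\<beta>' (snd z - s * fst z) * (snd v - s * fst v))
            + \<alpha>' (fst z) * fst v * \<beta> (snd z - s * fst z))) (at z)" for z
  proof -
    have 1: "((\<lambda>z. \<alpha> (fst z)) has_derivative (\<lambda>v. \<alpha>' (fst z) * fst v)) (at z)"
      using has_derivative_compose[OF has_derivative_fst[OF has_derivative_ident] \<alpha>[unfolded has_field_derivative_def]] .
    have "((\<lambda>z. snd z - s * fst z) has_derivative (\<lambda>v. snd v - s * fst v)) (at z)"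
      by (auto intro!: derivative_eq_intros)
    from has_derivative_compose[OF this \<beta>[unfolded has_field_derivative_def]]
    have 2: "((\<lambda>z. \<beta> (snd z - s * fst z)) has_derivative (\<lambda>v. \<beta>' (snd z - s * fst z) * (snd v - s * fst v))) (at z)" .
    from has_derivative_mult[OF 1 2] show ?thesis
      by (simp add: shear_product_def[abs_def])
  qed
  note D = frechet_derivative_at[OF this, symmetric]
  show "partial_t (shear_product s \<alpha> \<beta>) =
           (\<lambda>z. shear_product s \<alpha>' \<beta> z - s * shear_product s \<alpha> \<beta>' z)"
    and "partial_x (shear_product s \<alpha> \<beta>) = shear_product s \<alpha> \<beta>'"
    unfolding partial_t_def partial_x_def D by (simp_all add: shear_product_def fun_eq_iff algebra_simps)
qed

lemma test_function_shear_product: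
  assumes smooth: "\<And>k. cont_diff k \<alpha>" "\<And>k. cont_diff k \<beta>"
    and \<alpha>: "\<And>t. t \<notin> {l..r} \<Longrightarrow> \<alpha> t = 0" "0 < l" and \<beta>: "\<And>y. y \<notin> {l'..r'} \<Longrightarrow> \<beta> y = 0"
  shows "test_function (shear_product s \<alpha> \<beta>)"
proof -
  let ?K = "(\<lambda>(t, y). (t, y + s * t)) ` ({l..r} \<times> {l'..r'})"
  have "cont_diff k (\<lambda>z. \<alpha> (fst z + 0) * \<beta> ((snd z - s * fst z) + 0))" for k
    by (intro cont_diff_mult cont_diff_compose_affine[where L = fst]
          cont_diff_compose_affine[where L = "\<lambda>z. snd z - s * fst z"] smooth
          bounded_linear_sub bounded_linear_fst bounded_linear_snd bounded_linear_const_mult)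
  then have "cont_diff k (shear_product s \<alpha> \<beta>)" for k
    by (simp add: shear_product_def[abs_def])
  moreover have K: "{z. shear_product s \<alpha> \<beta> z \<noteq> 0} \<subseteq> ?K"
  proof
    fix z assume "z \<in> {z. shear_product s \<alpha> \<beta> z \<noteq> 0}"
    then show "z \<in> ?K" using shear_product_support[of l r \<alpha> l' r' \<beta> z s] \<alpha> \<beta> by fastforce
  qed
  have "compact (closure {z. shear_product s \<alpha> \<beta> z \<noteq> 0})"
    unfolding compact_closure by (rule bounded_subset[OF compact_imp_bounded[OF compact_shear_image] K])
  moreover have "closure {z. shear_product s \<alpha> \<beta> z \<noteq> 0} \<subseteq> {0<..} \<times> UNIV"
  proof -
    have "closure {z. shear_product s \<alpha> \<beta> z \<noteq> 0} \<subseteq> ?K"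
      by (rule closure_minimal[OF K compact_imp_closed[OF compact_shear_image]])
    also have "?K \<subseteq> {0<..} \<times> UNIV" using \<alpha>(2) by auto
    finally show ?thesis .
  qed
  ultimately show ?thesis by (simp add: test_function_def)
qed

lemma regular_distr_diff:
  assumes "integrable lborel (\<lambda>z. f z * P z)" "integrable lborel (\<lambda>z. f z * Q z)"
  shows "regular_distr f (\<lambda>z. P z - c * Q z) = regular_distr f P - c * regular_distr f Q"
proof -
  have S: "{0::real<..} \<times> (UNIV :: real set) \<in> sets lborel"
    by (simp add: open_Times borel_open)
  have int: "set_integrable lborel ({0<..} \<times> UNIV) (\<lambda>z. f z * P z)"
    "set_integrable lborel ({0<..} \<times> UNIV) (\<lambda>z. f z * Q z)"
    unfolding set_integrable_def
    by (rule integrable_mult_indicator[OF S assms(1)], rule integrable_mult_indicator[OF S assms(2)])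
  have "regular_distr f (\<lambda>z. P z - c * Q z) =
        (LINT z:{0<..} \<times> UNIV|lborel. f z * P z - c * (f z * Q z))"
    unfolding regular_distr_def by (simp add: algebra_simps)
  also have "\<dots> = regular_distr f P - c * regular_distr f Q"
    unfolding regular_distr_def using int by (simp add: set_integral_diff)
  finally show ?thesis .
qed

text \<open>
  For these test functions, the distributional derivatives of a step function are
  \<open>-s (b - a)\<close> and \<open>b - a\<close> times integration along the jump line. The \<open>\<alpha>'\<close> part of the time
  derivative drops out because \<open>\<alpha>'\<close> has integral zero.
\<close>
lemma regular_distr_partials_shear_product:
  assumes \<alpha>: "\<And>t. (\<alpha> has_real_derivative \<alpha>' t) (at t)" "continuous_on UNIV \<alpha>'"
      "\<And>t. t \<notin> {l..r} \<Longrightarrow> \<alpha> t = 0" "0 < l"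
    and \<beta>: "\<And>y. (\<beta> has_real_derivative \<beta>' y) (at y)" "continuous_on UNIV \<beta>'"
      "\<And>y. y \<notin> {l'..r'} \<Longrightarrow> \<beta> y = 0"
  shows "regular_distr (step_function s a b) (partial_t (shear_product s \<alpha> \<beta>)) =
           s * (b - a) * \<beta> 0 * (LINT t|lborel. \<alpha> t)"
    and "regular_distr (step_function s a b) (partial_x (shear_product s \<alpha> \<beta>)) =
           (a - b) * \<beta> 0 * (LINT t|lborel. \<alpha> t)"
proof -
  have cont: "continuous_on UNIV \<alpha>" "continuous_on UNIV \<beta>"
    by (rule DERIV_continuous_on[OF \<alpha>(1)], rule DERIV_continuous_on[OF \<beta>(1)])
  have \<alpha>'0: "\<alpha>' t = 0" if "t \<notin> {l..r}" for t
    by (rule derivative_outside_support[OF \<alpha>(1,3) that])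
  have \<beta>'0: "\<beta>' y = 0" if "y \<notin> {l'..r'}" for y
    by (rule derivative_outside_support[OF \<beta>(1,3) that])
  have jump: "(LINT y|lborel. (if y < 0 then a else b) * \<beta>' y) = (a - b) * \<beta> 0"
    by (rule integral_step_times_derivative[OF \<beta>])
  have "(LINT t|lborel. (if t < 0 then 1 else 1) * \<alpha>' t) = (1 - 1) * \<alpha> 0"
    by (rule integral_step_times_derivative[OF \<alpha>(1-3)])
  then have zero: "(LINT t|lborel. \<alpha>' t) = 0" by simp
  have t: "integrable lborel (\<lambda>z. step_function s a b z * shear_product s \<alpha>' \<beta> z)"
      "regular_distr (step_function s a b) (shear_product s \<alpha>' \<beta>) = 0"
    using regular_distr_shear_product[of \<alpha>' l r \<beta> l' r' s a b] \<alpha>(2,4) \<alpha>'0 cont(2) \<beta>(3) zero by auto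
  have x: "integrable lborel (\<lambda>z. step_function s a b z * shear_product s \<alpha> \<beta>' z)"
      "regular_distr (step_function s a b) (shear_product s \<alpha> \<beta>') = (LINT t|lborel. \<alpha> t) * ((a - b) * \<beta> 0)"
    using regular_distr_shear_product[of \<alpha> l r \<beta>' l' r' s a b] \<alpha>(3,4) \<beta>'0 cont(1) \<beta>(2) jump by auto
  show "regular_distr (step_function s a b) (partial_t (shear_product s \<alpha> \<beta>)) =
          s * (b - a) * \<beta> 0 * (LINT t|lborel. \<alpha> t)"
    unfolding partial_derivatives_shear_product[OF \<alpha>(1) \<beta>(1)]
    by (subst regular_distr_diff[OF t(1) x(1)]) (simp_all add: t(2) x(2) algebra_simps)
  show "regular_distr (step_function s a b) (partial_x (shear_product s \<alpha> \<beta>)) =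
          (a - b) * \<beta> 0 * (LINT t|lborel. \<alpha> t)"
    unfolding partial_derivatives_shear_product[OF \<alpha>(1) \<beta>(1)]
    by (simp add: x(2) algebra_simps)
qed

section \<open>The generalized Rankine-Hugoniot relation\<close>

text \<open>
  Both equations of the system have this form: for the mass equation take the weight \<open>w\<close>, for the
  momentum equation the weight \<open>s w\<close>, whose flux weight is \<open>s (s w)\<close>. The last term of the flux is
  the \<open>\<epsilon>\<close>-perturbation, which carries no singular part.
\<close>
lemma rankine_hugoniot_weight:
  assumes w: "continuous_on {0..} w" "w 0 = 0"
    and law: "conservation_law (step_plus_delta s a b w)
       (\<lambda>\<phi>. step_plus_delta s c d (\<lambda>t. s * w t) \<phi> - e * regular_distr (step_function s c' d') \<phi>)"
    and "0 \<le> t"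
  shows "w t * sqrt (1 + s\<^sup>2) = t * (s * (b - a) - ((d - c) - e * (d' - c')))"
proof -
  define A where "A = sqrt (1 + s\<^sup>2)"
  define k where "k = s * (b - a) - ((d - c) - e * (d' - c'))"
  \<comment> \<open>The claim is that \<open>g\<close> vanishes: the law says that its weak derivative does.\<close>
  define g where "g t = A * w t - k * t" for t
  have g: "continuous_on {0..} g"
    unfolding g_def by (intro continuous_intros w)
  obtain H :: "real \<Rightarrow> real" where H: "\<And>k. cont_diff k H" "\<And>x. x \<le> 0 \<Longrightarrow> H x = 0" "\<And>x. 1 \<le> x \<Longrightarrow> H x = 1"
    using smooth_step by blast
  \<comment> \<open>Since \<open>\<beta>\<close> is constant near 0, the delta part sees only \<open>\<alpha>\<close> and not \<open>\<beta>'\<close>.\<close>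
  define \<beta> where "\<beta> y = H (y + 2) - H (y + - 1)" for y
  have \<beta>: "cont_diff k \<beta>" for k
    unfolding \<beta>_def by (intro cont_diff_diff cont_diff_compose_affine bounded_linear_ident H)
  have \<beta>_supp: "\<beta> y = 0" if "y \<notin> {-2..2}" for y
    using that by (auto simp: \<beta>_def H not_le)
  have \<beta>_one: "\<beta> y = 1" if "y \<in> {-1<..<1}" for y
    using that by (simp add: \<beta>_def H)
  obtain \<beta>' where \<beta>': "\<And>x. (\<beta> has_real_derivative \<beta>' x) (at x)" "\<And>k. cont_diff k \<beta>'"
    using cont_diff_real_derivative[OF \<beta>] by blast
  have \<beta>0: "\<beta> 0 = 1" "\<beta>' 0 = 0"
    using \<beta>_one derivative_zero_where_constant[OF \<beta>'(1)[of 0], of "{-1<..<1}" 1] by auto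
  have const: "g p = g q" if "0 < p" "p < q" for p q
  proof (rule du_bois_reymond[OF g _ that])
    fix \<alpha> \<alpha>' l r
    assume l: "(0::real) < l" and smooth: "\<And>k. cont_diff k \<alpha>"
      and \<alpha>': "\<And>t. (\<alpha> has_real_derivative \<alpha>' t) (at t)" and supp: "\<And>t. t \<notin> {l..r} \<Longrightarrow> \<alpha> t = 0"
    have \<alpha>'_cont: "continuous_on UNIV \<alpha>'"
    proof -
      obtain f' where f': "\<And>x. (\<alpha> has_real_derivative f' x) (at x)" "\<And>k. cont_diff k f'"
        using cont_diff_real_derivative[OF smooth] by blast
      then have "f' = \<alpha>'" using DERIV_unique[OF f'(1) \<alpha>'] by blast
      with f'(2)[of 0] show ?thesis by simp
    qed
    have \<alpha>'_supp: "\<alpha>' t = 0" if "t \<notin> {l..r}" for t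
      by (rule derivative_outside_support[OF \<alpha>' supp that])
    have \<alpha>_cont: "continuous_on UNIV \<alpha>" using smooth[of 0] by simp
    let ?I = "LINT t|lborel. \<alpha> t"
    let ?\<phi> = "shear_product s \<alpha> \<beta>"
    have "test_function ?\<phi>"
      by (rule test_function_shear_product[OF smooth \<beta> supp l \<beta>_supp])
    then have law': "step_plus_delta s a b w (partial_t ?\<phi>) + step_plus_delta s c d (\<lambda>t. s * w t) (partial_x ?\<phi>)
        - e * regular_distr (step_function s c' d') (partial_x ?\<phi>) = 0"
      using law unfolding conservation_law_def by fastforce
    have delta_t: "delta_distr s w (partial_t ?\<phi>) = A * (LINT t:{0..}|lborel. w t * \<alpha>' t)"
    proof -
      have "delta_distr s w (partial_t ?\<phi>) = (LINT t:{0..}|lborel. A * (w t * \<alpha>' t))"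
        unfolding delta_distr_def partial_derivatives_shear_product[OF \<alpha>' \<beta>'(1)]
        by (simp add: shear_product_def \<beta>0 A_def mult_ac)
      then show ?thesis by simp
    qed
    have delta_x: "delta_distr s v (partial_x ?\<phi>) = 0" for v
      unfolding delta_distr_def partial_derivatives_shear_product[OF \<alpha>' \<beta>'(1)]
      by (simp add: shear_product_def \<beta>0)
    have \<beta>'_cont: "continuous_on UNIV \<beta>'" using \<beta>'(2)[of 0] by simp
    have step: "regular_distr (step_function s p q) (partial_t ?\<phi>) = s * (q - p) * ?I"
      "regular_distr (step_function s p q) (partial_x ?\<phi>) = (p - q) * ?I" for p q
      using regular_distr_partials_shear_product[of \<alpha> \<alpha>' l r \<beta> \<beta>' "-2" 2 s p q]
        \<alpha>' \<alpha>'_cont supp l \<beta>'(1) \<beta>'_cont \<beta>_supp \<beta>0 by auto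
    have weak: "A * (LINT t:{0..}|lborel. w t * \<alpha>' t) + k * ?I = 0"
      using law' unfolding step_plus_delta_def step delta_t delta_x
      by (simp add: \<beta>0 k_def algebra_simps)
    have parts: "(LINT t:{0..}|lborel. t * \<alpha>' t) = - ?I"
    proof -
      have cont: "continuous_on UNIV (\<lambda>t. \<alpha> t + t * \<alpha>' t)"
        by (intro continuous_intros \<alpha>_cont \<alpha>'_cont)
      have "((\<lambda>t. t * \<alpha> t) has_real_derivative \<alpha> t + t * \<alpha>' t) (at t)" for t
        by (auto intro!: derivative_eq_intros \<alpha>')
      from integral_step_times_derivative[OF this cont, of l r 1 1]
      have "(LINT t|lborel. \<alpha> t + t * \<alpha>' t) = 0" by (simp add: supp)
      moreover have "integrable lborel (\<lambda>t. 1 * \<alpha> t)" "integrable lborel (\<lambda>t. 1 * (t * \<alpha>' t))"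
        by (rule integrable_bounded_mult_compact_support[where K = "{l..r}" and B = 1];
            use supp \<alpha>'_supp \<alpha>_cont \<alpha>'_cont in \<open>auto intro: continuous_intros\<close>)+
      ultimately have "(LINT t|lborel. t * \<alpha>' t) = - ?I" by simp
      moreover have "(LINT t:{0..}|lborel. t * \<alpha>' t) = (LINT t|lborel. t * \<alpha>' t)"
        unfolding set_lebesgue_integral_def
        by (rule Bochner_Integration.integral_cong) (use l \<alpha>'_supp in \<open>auto simp: indicator_def\<close>)
      ultimately show ?thesis by simp
    qed
    have int: "set_integrable lborel {0..} (\<lambda>t. w t * \<alpha>' t)" "set_integrable lborel {0..} (\<lambda>t. t * \<alpha>' t)"
      by (rule set_integrable_mult_compact_support[OF _ \<alpha>'_cont \<alpha>'_supp], use w l in \<open>auto intro: continuous_intros\<close>)+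
    have "(LINT t:{0..}|lborel. g t * \<alpha>' t) =
          (LINT t:{0..}|lborel. A * (w t * \<alpha>' t) - k * (t * \<alpha>' t))"
      by (simp add: g_def algebra_simps)
    also have "\<dots> = A * (LINT t:{0..}|lborel. w t * \<alpha>' t) - k * (LINT t:{0..}|lborel. t * \<alpha>' t)"
      using int by (simp add: set_integral_diff)
    also have "\<dots> = 0" using weak parts by simp
    finally show "(LINT t:{0..}|lborel. g t * \<alpha>' t) = 0" .
  qed
  have "g t = 0"
  proof (cases "t = 0")
    case False
    then have "0 < t" using \<open>0 \<le> t\<close> by simp
    \<comment> \<open>Test functions do not reach \<open>t = 0\<close>; the initial value enters by continuity of \<open>g\<close>.\<close>
    have "(g \<longlongrightarrow> g 0) (at 0 within {0..})"
      using g by (simp add: continuous_on_def)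
    then have "(g \<longlongrightarrow> g 0) (at_right 0)"
      by (rule tendsto_within_subset) auto
    moreover have "eventually (\<lambda>p. g p = g t) (at_right 0)"
      using eventually_at_right_less[of 0] eventually_at_right_real[OF \<open>0 < t\<close>]
      by eventually_elim (use const in auto)
    then have "(g \<longlongrightarrow> g t) (at_right 0)" by (rule tendsto_eventually)
    ultimately have "g t = g 0"
      using tendsto_unique trivial_limit_at_right_real by blast
    then show ?thesis using w by (simp add: g_def)
  qed (use w in \<open>simp add: g_def\<close>)
  then show ?thesis by (simp add: g_def A_def k_def algebra_simps)
qed

lemma balanced_squares_imp_weighted_mean:
  fixes p m :: real
  assumes "0 < p" "0 < m" "up < s" "s < um" "p * (s - up)\<^sup>2 = m * (um - s)\<^sup>2"
  shows "s = (sqrt p * up + sqrt m * um) / (sqrt p + sqrt m)"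
proof -
  have "(sqrt p * (s - up))\<^sup>2 = (sqrt m * (um - s))\<^sup>2"
    using assms by (simp add: power_mult_distrib)
  then have "sqrt p * (s - up) = sqrt m * (um - s)"
    by (rule power2_eq_imp_eq) (use assms in auto)
  moreover have "0 < sqrt p + sqrt m" using assms by (simp add: add_pos_pos)
  ultimately show ?thesis by (simp add: field_simps)
qed

text \<open>
  The two equations give the slopes \<open>k\<close> of \<open>w sqrt (1 + s\<^sup>2)\<close> and \<open>s k\<close> of \<open>s w sqrt (1 + s\<^sup>2)\<close>.
  Expressing both through the jumps yields a quadratic equation for \<open>s\<close> in which the perturbation
  only replaces the densities \<open>\<rho>\<close> by \<open>\<rho> - \<epsilon>\<close>, because
  \<open>2 (up - um) s - (up\<^sup>2 - um\<^sup>2) = (s - um)\<^sup>2 - (s - up)\<^sup>2\<close>.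
\<close>
lemma delta_shock_weight_and_speed:
  assumes sol: "delta_shock_solution \<epsilon> \<rho>m um \<rho>p up s w" and pos: "\<epsilon> < \<rho>m" "\<epsilon> < \<rho>p"
  defines "k \<equiv> s * (\<rho>p - \<rho>m) - ((\<rho>p * up - \<rho>m * um) - 2 * \<epsilon> * (up - um))"
  shows "0 \<le> t \<Longrightarrow> w t * sqrt (1 + s\<^sup>2) = t * k"
    and "s = (sqrt (\<rho>p - \<epsilon>) * up + sqrt (\<rho>m - \<epsilon>) * um) / (sqrt (\<rho>p - \<epsilon>) + sqrt (\<rho>m - \<epsilon>))"
proof -
  have w: "continuous_on {0..} w" "w 0 = 0"
    and mass: "conservation_law (step_plus_delta s \<rho>m \<rho>p w)
      (\<lambda>\<phi>. step_plus_delta s (\<rho>m * um) (\<rho>p * up) (\<lambda>t. s * w t) \<phi>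
           - 2 * \<epsilon> * regular_distr (step_function s um up) \<phi>)"
    and mom: "conservation_law (step_plus_delta s (\<rho>m * um) (\<rho>p * up) (\<lambda>t. s * w t))
      (\<lambda>\<phi>. step_plus_delta s (\<rho>m * um\<^sup>2) (\<rho>p * up\<^sup>2) (\<lambda>t. s * (s * w t)) \<phi>
           - \<epsilon> * regular_distr (step_function s (um\<^sup>2) (up\<^sup>2)) \<phi>)"
    and s: "up < s" "s < um"
    using sol unfolding delta_shock_solution_def mass_density_def momentum_def momentum_flux_def
      velocity_def velocity_sq_def power2_eq_square[of s] mult.assoc[of s s] by blast+
  show weight: "w t * sqrt (1 + s\<^sup>2) = t * k" if "0 \<le> t" for t
    unfolding k_def by (rule rankine_hugoniot_weight[OF w mass that])
  have "continuous_on {0..} (\<lambda>t. s * w t)" "s * w 0 = 0"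
    using w by (auto intro: continuous_intros)
  \<comment> \<open>Both weights are linear, so comparing them at one positive time, here 1, loses nothing.\<close>
  from rankine_hugoniot_weight[OF this mom, of 1] weight[of 1]
  have "s * k = s * (\<rho>p * up - \<rho>m * um) - ((\<rho>p * up\<^sup>2 - \<rho>m * um\<^sup>2) - \<epsilon> * (up\<^sup>2 - um\<^sup>2))"
    by (simp add: mult.assoc)
  then have "(\<rho>p - \<epsilon>) * (s - up)\<^sup>2 = (\<rho>m - \<epsilon>) * (um - s)\<^sup>2"
    unfolding k_def by (simp add: power2_eq_square algebra_simps)
  then show "s = (sqrt (\<rho>p - \<epsilon>) * up + sqrt (\<rho>m - \<epsilon>) * um) / (sqrt (\<rho>p - \<epsilon>) + sqrt (\<rho>m - \<epsilon>))"
    using balanced_squares_imp_weighted_mean[of "\<rho>p - \<epsilon>" "\<rho>m - \<epsilon>" up s um] pos s by simp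
qed

section \<open>Continuity of the fields in the speed\<close>

lemma continuous_test_function: "test_function \<phi> \<Longrightarrow> continuous_on UNIV \<phi>"
  using cont_diff_continuous unfolding test_function_def by blast

lemma test_function_support:
  assumes "test_function \<phi>"
  obtains K T M where "compact K" "\<And>z. z \<notin> K \<Longrightarrow> \<phi> z = 0" "\<And>z. fst z \<le> 0 \<Longrightarrow> \<phi> z = 0"
    "0 < T" "\<And>z. T < fst z \<Longrightarrow> \<phi> z = 0" "0 < M" "\<And>z. \<bar>\<phi> z\<bar> \<le> M"
proof -
  define K where "K = closure {z. \<phi> z \<noteq> 0}"
  have K: "compact K" "K \<subseteq> {0<..} \<times> UNIV"
    using assms unfolding test_function_def K_def by blast+
  have cont: "continuous_on UNIV \<phi>" by (rule continuous_test_function[OF assms])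
  have out: "\<phi> z = 0" if "z \<notin> K" for z
    using that closure_subset[of "{z. \<phi> z \<noteq> 0}"] unfolding K_def by blast
  obtain T where T: "0 < T" "\<And>z. z \<in> K \<Longrightarrow> norm z \<le> T"
    using compact_imp_bounded[OF K(1)] bounded_pos by blast
  have "compact (\<phi> ` K)"
    by (intro compact_continuous_image continuous_on_subset[OF cont] K) auto
  then obtain M where M: "0 < M" "\<And>z. z \<in> K \<Longrightarrow> norm (\<phi> z) \<le> M"
    using compact_imp_bounded bounded_pos by (metis imageI)
  show ?thesis
  proof (rule that[OF K(1) out])
    show "\<phi> z = 0" if "fst z \<le> 0" for z
    proof (rule out)
      show "z \<notin> K" using that K(2) by auto
    qed
    show "\<phi> z = 0" if "T < fst z" for z
      using that T(2)[of z] out[of z] norm_fst_le[of "fst z" "snd z"] by fastforce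
    show "\<bar>\<phi> z\<bar> \<le> M" for z
      using M(2)[of z] out[of z] M(1) by (cases "z \<in> K") auto
  qed (use T M in auto)
qed

text \<open>
  Weak derivatives are moved onto the test function; this keeps them inside the test space, which is
  what allows a conservation law to pass to the limit.
\<close>
lemma test_function_directional_derivative:
  assumes "test_function \<phi>"
  shows "test_function (\<lambda>z. frechet_derivative \<phi> (at z) v)"
proof -
  define K where "K = closure {z. \<phi> z \<noteq> 0}"
  have smooth: "cont_diff (Suc k) \<phi>" for k
    using assms unfolding test_function_def by blast
  have "frechet_derivative \<phi> (at z) v = 0" if "z \<notin> K" for z
  proof -
    have "(\<phi> has_derivative (\<lambda>_. 0)) (at z)"
    proof (rule has_derivative_transform_within_open[OF has_derivative_const[of 0]])
      show "open (- K)" by (auto simp: K_def intro: open_Compl)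
      show "0 = \<phi> y" if "y \<in> - K" for y
        using that closure_subset[of "{z. \<phi> z \<noteq> 0}"] unfolding K_def by auto
    qed (use that in simp)
    from frechet_derivative_at[OF this] show ?thesis by metis
  qed
  then have sub: "closure {z. frechet_derivative \<phi> (at z) v \<noteq> 0} \<subseteq> K"
    by (intro closure_minimal) (auto simp: K_def)
  have K: "compact K" "K \<subseteq> {0<..} \<times> UNIV"
    using assms unfolding test_function_def K_def by blast+
  have "compact (closure {z. frechet_derivative \<phi> (at z) v \<noteq> 0})"
    using compact_Int_closed[OF K(1) closed_closure] sub by (metis inf.absorb2)
  moreover have "cont_diff k (\<lambda>z. frechet_derivative \<phi> (at z) v)" for k
    using smooth[of k] unfolding cont_diff.simps by blast
  ultimately show ?thesis
    using sub K(2) unfolding test_function_def by blast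
qed

lemma AE_off_line: "AE z in lborel. snd z \<noteq> \<sigma> * fst (z :: real \<times> real)"
proof -
  have "negligible {z::real \<times> real. (- \<sigma>, 1) \<bullet> z = 0}"
    by (rule negligible_hyperplane) (simp add: zero_prod_def)
  also have "{z::real \<times> real. (- \<sigma>, 1) \<bullet> z = 0} = {z. snd z = \<sigma> * fst z}"
    by (auto simp: inner_prod_def)
  finally have "AE z in lebesgue. z \<notin> {z::real \<times> real. snd z = \<sigma> * fst z}"
    by (intro AE_not_in) (simp add: negligible_iff_null_sets)
  then show ?thesis by (simp add: AE_completion_iff)
qed

lemma step_function_pointwise_limit:
  assumes "(s \<longlongrightarrow> \<sigma>) F" "snd z \<noteq> \<sigma> * fst z"
  shows "((\<lambda>i. step_function (s i) a b z) \<longlongrightarrow> step_function \<sigma> a b z) F"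
proof (rule tendsto_eventually)
  have lim: "((\<lambda>i. s i * fst z) \<longlongrightarrow> \<sigma> * fst z) F"
    by (intro tendsto_intros assms)
  show "\<forall>\<^sub>F i in F. step_function (s i) a b z = step_function \<sigma> a b z"
  proof (cases "snd z < \<sigma> * fst z")
    case True
    from order_tendstoD(1)[OF lim True] show ?thesis
      by (rule eventually_mono) (use True in \<open>simp add: step_function_def split_beta\<close>)
  next
    case False
    then have "\<sigma> * fst z < snd z" using assms(2) by simp
    from order_tendstoD(2)[OF lim this] show ?thesis
      by (rule eventually_mono) (use False in \<open>simp add: step_function_def split_beta\<close>)
  qed
qed

text \<open>
  The integrands converge off the limiting jump line, which is a null set. Dominated convergence is
  a statement about sequences, so the result is stated as continuity in the speed and then
  composed with an arbitrary filter.
\<close>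
lemma regular_distr_step_tendsto:
  assumes \<phi>: "test_function \<phi>" and "(s \<longlongrightarrow> \<sigma>) F"
  shows "((\<lambda>i. regular_distr (step_function (s i) a b) \<phi>) \<longlongrightarrow> regular_distr (step_function \<sigma> a b) \<phi>) F"
proof -
  obtain K where K: "compact K" "\<And>z. z \<notin> K \<Longrightarrow> \<phi> z = 0" "\<And>z. fst z \<le> 0 \<Longrightarrow> \<phi> z = 0"
    using test_function_support[OF \<phi>] by metis
  have lborel: "regular_distr f \<phi> = (LINT z|lborel. f z * \<phi> z)" for f
    by (rule regular_distr_eq_lborel) (fact K(3))
  note cont = continuous_test_function[OF \<phi>]
  have [measurable]: "\<phi> \<in> borel_measurable borel"
    using cont by (rule borel_measurable_continuous_onI)
  have "isCont (\<lambda>s. regular_distr (step_function s a b) \<phi>) \<sigma>"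
    unfolding continuous_at_sequentially comp_def lborel
  proof (intro allI impI integral_dominated_convergence)
    fix x assume x: "x \<longlonglongrightarrow> \<sigma>"
    have "integrable lborel (\<lambda>z. (\<bar>a\<bar> + \<bar>b\<bar>) * \<bar>\<phi> z\<bar>)"
      by (rule integrable_bounded_mult_compact_support[where K = K and B = "\<bar>a\<bar> + \<bar>b\<bar>"])
         (use K cont in \<open>auto intro: continuous_intros\<close>)
    then show "integrable lborel (\<lambda>z. (\<bar>a\<bar> + \<bar>b\<bar>) * \<bar>\<phi> z\<bar>)" .
    show "AE z in lborel. (\<lambda>n. step_function (x n) a b z * \<phi> z) \<longlonglongrightarrow> step_function \<sigma> a b z * \<phi> z"
      using AE_off_line
      by eventually_elim (intro tendsto_intros step_function_pointwise_limit[OF x])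
    show "AE z in lborel. norm (step_function (x n) a b z * \<phi> z) \<le> (\<bar>a\<bar> + \<bar>b\<bar>) * \<bar>\<phi> z\<bar>" for n
      by (simp add: abs_mult mult_right_mono step_function_bound)
  qed measurable
  from isCont_tendsto_compose[OF this assms(2)] show ?thesis .
qed

lemma ray_integral_tendsto:
  assumes \<phi>: "test_function \<phi>" and "(s \<longlongrightarrow> \<sigma>) F"
  shows "((\<lambda>i. LINT t:{0..}|lborel. t * \<phi> (t, s i * t)) \<longlongrightarrow> (LINT t:{0..}|lborel. t * \<phi> (t, \<sigma> * t))) F"
proof -
  obtain T M where T: "0 < T" "\<And>z. T < fst z \<Longrightarrow> \<phi> z = 0" and M: "0 < M" "\<And>z. \<bar>\<phi> z\<bar> \<le> M"
    using test_function_support[OF \<phi>] by metis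
  note cont = continuous_test_function[OF \<phi>]
  have [measurable]: "(\<lambda>t. \<phi> (t, r * t)) \<in> borel_measurable borel" for r
    by (rule borel_measurable_continuous_onI)
       (intro continuous_on_compose2[OF cont] continuous_intros subset_UNIV)
  have "isCont (\<lambda>r. LINT t:{0..}|lborel. t * \<phi> (t, r * t)) \<sigma>"
    unfolding continuous_at_sequentially comp_def set_lebesgue_integral_def
  proof (intro allI impI integral_dominated_convergence)
    fix x assume x: "x \<longlonglongrightarrow> \<sigma>"
    show "integrable lborel (\<lambda>t. indicator {0..T} t *\<^sub>R (T * M))"
      by (rule borel_integrable_compact) auto
    show "AE t in lborel. (\<lambda>n. indicator {0..} t *\<^sub>R (t * \<phi> (t, x n * t))) \<longlonglongrightarrow>
            indicator {0..} t *\<^sub>R (t * \<phi> (t, \<sigma> * t))"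
    proof (intro AE_I2 tendsto_scaleR tendsto_mult tendsto_const)
      fix t
      have "isCont \<phi> (t, \<sigma> * t)"
        using cont by (simp add: continuous_on_eq_continuous_at)
      moreover have "(\<lambda>n. (t, x n * t)) \<longlonglongrightarrow> (t, \<sigma> * t)"
        by (intro tendsto_intros x)
      ultimately show "(\<lambda>n. \<phi> (t, x n * t)) \<longlonglongrightarrow> \<phi> (t, \<sigma> * t)"
        by (rule isCont_tendsto_compose)
    qed
    show "AE t in lborel. norm (indicator {0..} t *\<^sub>R (t * \<phi> (t, x n * t))) \<le> indicator {0..T} t *\<^sub>R (T * M)" for n
    proof (intro AE_I2)
      fix t
      show "norm (indicator {0..} t *\<^sub>R (t * \<phi> (t, x n * t))) \<le> indicator {0..T} t *\<^sub>R (T * M)"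
        using T(2)[of "(t, x n * t)"] mult_mono[of "\<bar>t\<bar>" T "\<bar>\<phi> (t, x n * t)\<bar>" M] M(2) T(1) M(1)
        by (cases "T < t") (auto simp: indicator_def abs_mult)
    qed
  qed measurable
  from isCont_tendsto_compose[OF this assms(2)] show ?thesis .
qed

text \<open>
  The arc-length factor cancels, so a linear weight enters only through its slope \<open>k\<close>. The remaining
  integral depends on the speed alone.
\<close>
lemma delta_distr_linear_weight:
  assumes "\<And>t. 0 \<le> t \<Longrightarrow> w t * sqrt (1 + s\<^sup>2) = t * k"
  shows "delta_distr s w \<phi> = k * (LINT t:{0..}|lborel. t * \<phi> (t, s * t))"
proof -
  have "delta_distr s w \<phi> = (LINT t:{0..}|lborel. k * (t * \<phi> (t, s * t)))"
    unfolding delta_distr_def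
  proof (rule set_lebesgue_integral_cong)
    show "\<forall>t. t \<in> {0..} \<longrightarrow> w t * \<phi> (t, s * t) * sqrt (1 + s\<^sup>2) = k * (t * \<phi> (t, s * t))"
    proof (intro allI impI)
      fix t :: real assume "t \<in> {0..}"
      then show "w t * \<phi> (t, s * t) * sqrt (1 + s\<^sup>2) = k * (t * \<phi> (t, s * t))"
        using arg_cong[OF assms[of t], of "\<lambda>x. x * \<phi> (t, s * t)"] by (simp add: mult_ac)
    qed
  qed simp
  then show ?thesis by simp
qed

lemma step_plus_delta_tendsto:
  assumes "(s \<longlongrightarrow> \<sigma>) F" "(k \<longlongrightarrow> k0) F"
    and w: "\<forall>\<^sub>F i in F. \<forall>t\<ge>0. w i t * sqrt (1 + (s i)\<^sup>2) = t * k i"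
    and w0: "\<And>t. 0 \<le> t \<Longrightarrow> w0 t * sqrt (1 + \<sigma>\<^sup>2) = t * k0"
  shows "distr_tendsto (\<lambda>i. step_plus_delta (s i) a b (w i)) (step_plus_delta \<sigma> a b w0) F"
  unfolding distr_tendsto_def step_plus_delta_def
proof (intro allI impI tendsto_add regular_distr_step_tendsto assms(1))
  fix \<phi> assume \<phi>: "test_function \<phi>"
  have "((\<lambda>i. k i * (LINT t:{0..}|lborel. t * \<phi> (t, s i * t))) \<longlongrightarrow>
          k0 * (LINT t:{0..}|lborel. t * \<phi> (t, \<sigma> * t))) F"
    by (intro tendsto_mult assms ray_integral_tendsto \<phi>)
  moreover have "\<forall>\<^sub>F i in F. k i * (LINT t:{0..}|lborel. t * \<phi> (t, s i * t)) = delta_distr (s i) (w i) \<phi>"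
    using w by eventually_elim (rule delta_distr_linear_weight[symmetric], blast)
  moreover have "delta_distr \<sigma> w0 \<phi> = k0 * (LINT t:{0..}|lborel. t * \<phi> (t, \<sigma> * t))"
    by (rule delta_distr_linear_weight) (fact w0)
  ultimately show "((\<lambda>i. delta_distr (s i) (w i) \<phi>) \<longlongrightarrow> delta_distr \<sigma> w0 \<phi>) F"
    by (simp add: Lim_transform_eventually)
qed

lemma conservation_law_limit:
  assumes "\<forall>\<^sub>F i in F. conservation_law (D i) (E i)"
    and "distr_tendsto D D0 F" "distr_tendsto E E0 F" and "F \<noteq> bot"
  shows "conservation_law D0 E0"
  unfolding conservation_law_def
proof (intro allI impI)
  fix \<phi> assume \<phi>: "test_function \<phi>"
  have "test_function (partial_t \<phi>)" "test_function (partial_x \<phi>)"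
    using test_function_directional_derivative[OF \<phi>]
    unfolding partial_t_def[abs_def] partial_x_def[abs_def] by blast+
  then have "((\<lambda>i. - D i (partial_t \<phi>) - E i (partial_x \<phi>)) \<longlongrightarrow> - D0 (partial_t \<phi>) - E0 (partial_x \<phi>)) F"
    using assms(2,3) unfolding distr_tendsto_def by (intro tendsto_intros) auto
  moreover have "\<forall>\<^sub>F i in F. - D i (partial_t \<phi>) - E i (partial_x \<phi>) = 0"
    using assms(1) by eventually_elim (use \<phi> in \<open>auto simp: conservation_law_def\<close>)
  then have "((\<lambda>i. - D i (partial_t \<phi>) - E i (partial_x \<phi>)) \<longlongrightarrow> 0) F"
    by (rule tendsto_eventually)
  ultimately show "- D0 (partial_t \<phi>) - E0 (partial_x \<phi>) = 0"
    using assms(4) tendsto_unique by blast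
qed

lemma distr_tendsto_diff_mult:
  assumes "distr_tendsto D D0 F" "distr_tendsto E E0 F" "(c \<longlongrightarrow> c0) F"
  shows "distr_tendsto (\<lambda>i \<phi>. D i \<phi> - c i * E i \<phi>) (\<lambda>\<phi>. D0 \<phi> - c0 * E0 \<phi>) F"
  using assms unfolding distr_tendsto_def by (auto intro!: tendsto_intros)

section \<open>The vanishing-pressure limit\<close>

theorem theorem3p2:
  fixes \<rho>m um \<rho>p up \<sigma> :: real
    and s :: "real \<Rightarrow> real" and w :: "real \<Rightarrow> real \<Rightarrow> real"
  assumes "0 < \<rho>m" and "0 < \<rho>p" and "um > up" and "\<rho>m \<noteq> \<rho>p"
    and "\<And>\<epsilon>. 0 < \<epsilon> \<Longrightarrow> 2 * \<epsilon> \<le> \<rho>m \<Longrightarrow> 2 * \<epsilon> \<le> \<rho>p \<Longrightarrow>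
           delta_shock_solution \<epsilon> \<rho>m um \<rho>p up (s \<epsilon>) (w \<epsilon>)"
    and "\<sigma> = (sqrt \<rho>p * up + sqrt \<rho>m * um) / (sqrt \<rho>p + sqrt \<rho>m)"
  shows "\<exists>w0.
    distr_tendsto (\<lambda>\<epsilon>. mass_density \<rho>m \<rho>p (s \<epsilon>) (w \<epsilon>)) (mass_density \<rho>m \<rho>p \<sigma> w0) (at_right 0) \<and>
    distr_tendsto (\<lambda>\<epsilon>. velocity um up (s \<epsilon>)) (velocity um up \<sigma>) (at_right 0) \<and>
    distr_tendsto (\<lambda>\<epsilon>. momentum \<rho>m um \<rho>p up (s \<epsilon>) (w \<epsilon>)) (momentum \<rho>m um \<rho>p up \<sigma> w0) (at_right 0) \<and>
    delta_shock_solution 0 \<rho>m um \<rho>p up \<sigma> w0 \<and>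
    distr_eq (mass_density \<rho>m \<rho>p \<sigma> w0)
      (step_plus_delta \<sigma> \<rho>m \<rho>p
        (\<lambda>t. t / sqrt (1 + \<sigma>\<^sup>2) * (\<sigma> * (\<rho>p - \<rho>m) - (\<rho>p * up - \<rho>m * um)))) \<and>
    distr_eq (momentum \<rho>m um \<rho>p up \<sigma> w0)
      (step_plus_delta \<sigma> (\<rho>m * um) (\<rho>p * up)
        (\<lambda>t. t / sqrt (1 + \<sigma>\<^sup>2) * (\<sigma> * (\<rho>p * up - \<rho>m * um) - (\<rho>p * up\<^sup>2 - \<rho>m * um\<^sup>2))))"
proof -
  let ?F = "at_right (0::real)"
  define k where "k \<epsilon> = s \<epsilon> * (\<rho>p - \<rho>m) - ((\<rho>p * up - \<rho>m * um) - 2 * \<epsilon> * (up - um))" for \<epsilon>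
  define k0 where "k0 = \<sigma> * (\<rho>p - \<rho>m) - (\<rho>p * up - \<rho>m * um)"
  define w0 where "w0 t = t / sqrt (1 + \<sigma>\<^sup>2) * k0" for t
  have "\<forall>\<^sub>F \<epsilon> in ?F. \<epsilon> < min \<rho>m \<rho>p / 2"
    by (rule eventually_at_rightI[of 0 "min \<rho>m \<rho>p / 2"]) (use assms(1,2) in auto)
  moreover have "\<forall>\<^sub>F \<epsilon> in ?F. 0 < \<epsilon>" by (rule eventually_at_right_less)
  ultimately have small: "\<forall>\<^sub>F \<epsilon> in ?F. 0 < \<epsilon> \<and> 2 * \<epsilon> \<le> \<rho>m \<and> 2 * \<epsilon> \<le> \<rho>p"
    by eventually_elim auto
  have sol: "\<forall>\<^sub>F \<epsilon> in ?F. delta_shock_solution \<epsilon> \<rho>m um \<rho>p up (s \<epsilon>) (w \<epsilon>)"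
    using small by eventually_elim (use assms(5) in blast)

  have \<epsilon>: "((\<lambda>\<epsilon>. \<epsilon>) \<longlongrightarrow> 0) ?F" by (rule tendsto_ident_at)
  have root: "0 < sqrt \<rho>p" "0 < sqrt \<rho>m" using assms(1,2) by auto
  have "((\<lambda>\<epsilon>. (sqrt (\<rho>p - \<epsilon>) * up + sqrt (\<rho>m - \<epsilon>) * um) / (sqrt (\<rho>p - \<epsilon>) + sqrt (\<rho>m - \<epsilon>)))
          \<longlongrightarrow> (sqrt (\<rho>p - 0) * up + sqrt (\<rho>m - 0) * um) / (sqrt (\<rho>p - 0) + sqrt (\<rho>m - 0))) ?F"
    using add_pos_pos[OF root] by (intro tendsto_intros \<epsilon>) simp
  moreover have "\<forall>\<^sub>F \<epsilon> in ?F. (sqrt (\<rho>p - \<epsilon>) * up + sqrt (\<rho>m - \<epsilon>) * um) / (sqrt (\<rho>p - \<epsilon>) + sqrt (\<rho>m - \<epsilon>)) = s \<epsilon>"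
    using small sol by eventually_elim (rule delta_shock_weight_and_speed(2)[symmetric], auto)
  ultimately have s_lim: "(s \<longlongrightarrow> \<sigma>) ?F"
    unfolding assms(6) by (simp add: Lim_transform_eventually)
  have "(k \<longlongrightarrow> \<sigma> * (\<rho>p - \<rho>m) - ((\<rho>p * up - \<rho>m * um) - 2 * 0 * (up - um))) ?F"
    unfolding k_def by (intro tendsto_intros s_lim \<epsilon>)
  then have k_lim: "(k \<longlongrightarrow> k0) ?F" by (simp add: k0_def)

  have w: "\<forall>\<^sub>F \<epsilon> in ?F. \<forall>t\<ge>0. w \<epsilon> t * sqrt (1 + (s \<epsilon>)\<^sup>2) = t * k \<epsilon>"
    using small sol
    by eventually_elim (auto intro!: delta_shock_weight_and_speed(1) simp: k_def)
  have "sqrt (1 + \<sigma>\<^sup>2) \<noteq> 0" by (simp add: add_nonneg_eq_0_iff)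
  then have w0: "w0 t * sqrt (1 + \<sigma>\<^sup>2) = t * k0" for t by (simp add: w0_def)

  have mass: "distr_tendsto (\<lambda>\<epsilon>. mass_density \<rho>m \<rho>p (s \<epsilon>) (w \<epsilon>)) (mass_density \<rho>m \<rho>p \<sigma> w0) ?F"
    unfolding mass_density_def by (rule step_plus_delta_tendsto[OF s_lim k_lim w w0])
  have mom: "distr_tendsto (\<lambda>\<epsilon>. momentum \<rho>m um \<rho>p up (s \<epsilon>) (w \<epsilon>)) (momentum \<rho>m um \<rho>p up \<sigma> w0) ?F"
    unfolding momentum_def
  proof (rule step_plus_delta_tendsto[OF s_lim tendsto_mult[OF s_lim k_lim]])
    show "\<forall>\<^sub>F \<epsilon> in ?F. \<forall>t\<ge>0. s \<epsilon> * w \<epsilon> t * sqrt (1 + (s \<epsilon>)\<^sup>2) = t * (s \<epsilon> * k \<epsilon>)"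
      using w by eventually_elim (simp add: mult.assoc)
  qed (simp add: mult.assoc w0)
  have flux: "distr_tendsto (\<lambda>\<epsilon>. momentum_flux \<rho>m um \<rho>p up (s \<epsilon>) (w \<epsilon>)) (momentum_flux \<rho>m um \<rho>p up \<sigma> w0) ?F"
    unfolding momentum_flux_def
  proof (rule step_plus_delta_tendsto[OF s_lim tendsto_mult[OF tendsto_power[OF s_lim] k_lim]])
    show "\<forall>\<^sub>F \<epsilon> in ?F. \<forall>t\<ge>0. (s \<epsilon>)\<^sup>2 * w \<epsilon> t * sqrt (1 + (s \<epsilon>)\<^sup>2) = t * ((s \<epsilon>)\<^sup>2 * k \<epsilon>)"
      using w by eventually_elim (simp add: mult.assoc)
  qed (simp add: mult.assoc w0)
  have vel: "distr_tendsto (\<lambda>\<epsilon>. velocity um up (s \<epsilon>)) (velocity um up \<sigma>) ?F"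
    and vel_sq: "distr_tendsto (\<lambda>\<epsilon>. velocity_sq um up (s \<epsilon>)) (velocity_sq um up \<sigma>) ?F"
    unfolding distr_tendsto_def velocity_def velocity_sq_def
    by (auto intro: regular_distr_step_tendsto s_lim)

  have "conservation_law (mass_density \<rho>m \<rho>p \<sigma> w0)
          (\<lambda>\<phi>. momentum \<rho>m um \<rho>p up \<sigma> w0 \<phi> - 2 * 0 * velocity um up \<sigma> \<phi>)"
  proof (rule conservation_law_limit[OF _ mass])
    show "distr_tendsto (\<lambda>\<epsilon> \<phi>. momentum \<rho>m um \<rho>p up (s \<epsilon>) (w \<epsilon>) \<phi> - 2 * \<epsilon> * velocity um up (s \<epsilon>) \<phi>)
            (\<lambda>\<phi>. momentum \<rho>m um \<rho>p up \<sigma> w0 \<phi> - 2 * 0 * velocity um up \<sigma> \<phi>) ?F"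
      by (intro distr_tendsto_diff_mult mom vel tendsto_intros)
  qed (use sol in \<open>auto elim: eventually_mono simp: delta_shock_solution_def\<close>)
  moreover have "conservation_law (momentum \<rho>m um \<rho>p up \<sigma> w0)
          (\<lambda>\<phi>. momentum_flux \<rho>m um \<rho>p up \<sigma> w0 \<phi> - 0 * velocity_sq um up \<sigma> \<phi>)"
  proof (rule conservation_law_limit[OF _ mom])
    show "distr_tendsto (\<lambda>\<epsilon> \<phi>. momentum_flux \<rho>m um \<rho>p up (s \<epsilon>) (w \<epsilon>) \<phi> - \<epsilon> * velocity_sq um up (s \<epsilon>) \<phi>)
            (\<lambda>\<phi>. momentum_flux \<rho>m um \<rho>p up \<sigma> w0 \<phi> - 0 * velocity_sq um up \<sigma> \<phi>) ?F"
      by (intro distr_tendsto_diff_mult flux vel_sq tendsto_intros)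
  qed (use sol in \<open>auto elim: eventually_mono simp: delta_shock_solution_def\<close>)
  moreover have "up < \<sigma>" "\<sigma> < um"
    using root assms(3) unfolding assms(6)
    by (auto simp: field_simps add_pos_pos)
  moreover have "continuous_on {0..} w0" "w0 0 = 0"
    unfolding w0_def[abs_def] by (auto intro!: continuous_intros simp: add_nonneg_eq_0_iff)
  ultimately have shock: "delta_shock_solution 0 \<rho>m um \<rho>p up \<sigma> w0"
    by (simp add: delta_shock_solution_def)

  \<comment> \<open>The momentum weight is \<open>\<sigma>\<close> times the mass weight; the square identity satisfied by \<open>\<sigma>\<close>
      rewrites it in terms of the momentum jumps.\<close>
  have "\<sigma> * k0 = \<sigma> * (\<rho>p * up - \<rho>m * um) - (\<rho>p * up\<^sup>2 - \<rho>m * um\<^sup>2)"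
  proof -
    have "\<rho>p = sqrt \<rho>p * sqrt \<rho>p" "\<rho>m = sqrt \<rho>m * sqrt \<rho>m" using assms(1,2) by auto
    moreover have "\<sigma> * (sqrt \<rho>p + sqrt \<rho>m) = sqrt \<rho>p * up + sqrt \<rho>m * um"
      using add_pos_pos[OF root] unfolding assms(6) by simp
    then have "sqrt \<rho>p * (\<sigma> - up) = sqrt \<rho>m * (um - \<sigma>)"
      by (simp add: algebra_simps)
    ultimately have "\<rho>p * (\<sigma> - up)\<^sup>2 = \<rho>m * (um - \<sigma>)\<^sup>2"
      by (metis power2_eq_square power_mult_distrib)
    then show ?thesis
      unfolding k0_def by (simp add: power2_eq_square algebra_simps)
  qed
  then have "\<sigma> * w0 t = t / sqrt (1 + \<sigma>\<^sup>2) * (\<sigma> * (\<rho>p * up - \<rho>m * um) - (\<rho>p * up\<^sup>2 - \<rho>m * um\<^sup>2))" for t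
    unfolding w0_def by (metis mult.left_commute)
  then have "distr_eq (momentum \<rho>m um \<rho>p up \<sigma> w0)
      (step_plus_delta \<sigma> (\<rho>m * um) (\<rho>p * up)
        (\<lambda>t. t / sqrt (1 + \<sigma>\<^sup>2) * (\<sigma> * (\<rho>p * up - \<rho>m * um) - (\<rho>p * up\<^sup>2 - \<rho>m * um\<^sup>2))))"
    by (simp add: distr_eq_def momentum_def)
  moreover have "distr_eq (mass_density \<rho>m \<rho>p \<sigma> w0)
      (step_plus_delta \<sigma> \<rho>m \<rho>p
        (\<lambda>t. t / sqrt (1 + \<sigma>\<^sup>2) * (\<sigma> * (\<rho>p - \<rho>m) - (\<rho>p * up - \<rho>m * um))))"
    by (simp add: distr_eq_def mass_density_def w0_def[abs_def] k0_def)
  ultimately show ?thesis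
    using mass vel mom shock by blast
qed

end
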